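(* Let $G$ be a graph, let $l$ be an intersecting supermodular subadditive integer-valued function on subsets of $V(G)$, and let $\ell$ be a $2$-intersecting supermodular subadditive integer-valued function on subsets of $V(G)$. Let $F$ and $\mathcal{F}$ be two edge-disjoint spanning subgraphs of $G$ such that $F$ is $l$-sparse and $\mathcal{F}$ is $\ell$-sparse, and such that $|E(F\cup\mathcal{F})|$ is maximum among all such pairs. Then there is a partition $P$ of $V(G)$ with the following properties: (1) for every $A\in P$, the graph $F[A]$ is $l$-partition-connected; (2) no edge of $E(G)\setminus E(F\cup\mathcal{F})$ joins different parts of $P$; (3) for every $xy\in E(G)\setminus E(\mathcal{F})$ with $x,y\in A\in P$, there is a vertex set $X$ with $\{x,y\}\subseteq X\subseteq A$ such that $\mathcal{F}[X]$ is $\ell$-rigid.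
   Context: Graphs are finite, loopless, multiple edges allowed. $e_H(X)$ is the number of edges of $H$ with both ends in $X$; for a partition $P$, $e_H(P)$ is the number of edges joining different parts. Set functions are zero on $\emptyset$, $f(v)=f(\{v\})$. $f$ is $c$-intersecting supermodular if $f(A\cap B)+f(A\cup B)\ge f(A)+f(B)$ whenever $|A\cap B|\ge c$ (intersecting means $c=1$); subadditive if $f(A)+f(B)\ge f(A\cup B)$ for disjoint $A,B$. A spanning subgraph $F$ is $f$-sparse if $e_F(X)\le\sum_{v\in X}f(v)-f(X)$ for all $X$. A graph $H$ is $f$-rigid if it has a spanning $f$-sparse subgraph with exactly $\sum_{v\in V(H)}f(v)-f(V(H))$ edges, and $f$-partition-connected if $e_H(P)\ge\sum_{A\in P}f(A)-f(V(H))$ for every partition $P$ of $V(H)$ (with $f$ restricted to subsets of $V(H)$). *)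

theory Defs
  imports Main "HOL-Library.Disjoint_Sets"
begin

text \<open>Undirected multigraphs: edges are abstract objects, each with a two-element set of ends,
  so parallel edges are allowed and loops are not.\<close>

record ('v, 'e) mgraph =
  verts :: "'v set"
  edges :: "'e set"
  ends :: "'e \<Rightarrow> 'v set"

definition multigraph :: "('v, 'e) mgraph \<Rightarrow> bool" where
  "multigraph G \<longleftrightarrow> finite (verts G) \<and> finite (edges G) \<and>
     (\<forall>e \<in> edges G. ends G e \<subseteq> verts G \<and> card (ends G e) = 2)"

definition spanning_subgraph :: "('v, 'e) mgraph \<Rightarrow> ('v, 'e) mgraph \<Rightarrow> bool" where
  "spanning_subgraph H G \<longleftrightarrow> verts H = verts G \<and> edges H \<subseteq> edges G \<and>
     (\<forall>e \<in> edges H. ends H e = ends G e)"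

definition induced_subgraph :: "('v, 'e) mgraph \<Rightarrow> 'v set \<Rightarrow> ('v, 'e) mgraph" where
  "induced_subgraph H X =
     \<lparr>verts = X, edges = {e \<in> edges H. ends H e \<subseteq> X}, ends = ends H\<rparr>"

definition edges_in :: "('v, 'e) mgraph \<Rightarrow> 'v set \<Rightarrow> nat" where
  "edges_in H X = card {e \<in> edges H. ends H e \<subseteq> X}"

definition joins_parts :: "('v, 'e) mgraph \<Rightarrow> 'v set set \<Rightarrow> 'e \<Rightarrow> bool" where
  "joins_parts H P e \<longleftrightarrow>
     (\<exists>x y. ends H e = {x, y} \<and> (\<exists>A \<in> P. \<exists>B \<in> P. A \<noteq> B \<and> x \<in> A \<and> y \<in> B))"

definition edges_across :: "('v, 'e) mgraph \<Rightarrow> 'v set set \<Rightarrow> nat" where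
  "edges_across H P = card {e \<in> edges H. joins_parts H P e}"

definition intersecting_supermodular :: "nat \<Rightarrow> 'v set \<Rightarrow> ('v set \<Rightarrow> int) \<Rightarrow> bool" where
  "intersecting_supermodular c V f \<longleftrightarrow>
     (\<forall>A B. A \<subseteq> V \<longrightarrow> B \<subseteq> V \<longrightarrow> card (A \<inter> B) \<ge> c \<longrightarrow>
        f (A \<inter> B) + f (A \<union> B) \<ge> f A + f B)"

definition subadditive_on :: "'v set \<Rightarrow> ('v set \<Rightarrow> int) \<Rightarrow> bool" where
  "subadditive_on V f \<longleftrightarrow>
     (\<forall>A B. A \<subseteq> V \<longrightarrow> B \<subseteq> V \<longrightarrow> A \<inter> B = {} \<longrightarrow> f A + f B \<ge> f (A \<union> B))"

definition sparse :: "('v set \<Rightarrow> int) \<Rightarrow> ('v, 'e) mgraph \<Rightarrow> bool" where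
  "sparse f H \<longleftrightarrow>
     (\<forall>X. X \<subseteq> verts H \<longrightarrow> int (edges_in H X) \<le> (\<Sum>v\<in>X. f {v}) - f X)"

definition rigid :: "('v set \<Rightarrow> int) \<Rightarrow> ('v, 'e) mgraph \<Rightarrow> bool" where
  "rigid f H \<longleftrightarrow>
     (\<exists>K. spanning_subgraph K H \<and> sparse f K \<and>
        int (card (edges K)) = (\<Sum>v\<in>verts H. f {v}) - f (verts H))"

definition partition_connected :: "('v set \<Rightarrow> int) \<Rightarrow> ('v, 'e) mgraph \<Rightarrow> bool" where
  "partition_connected f H \<longleftrightarrow>
     (\<forall>P. partition_on (verts H) P \<longrightarrow>
        int (edges_across H P) \<ge> (\<Sum>A\<in>P. f A) - f (verts H))"

definition sparse_pair ::
  "('v, 'e) mgraph \<Rightarrow> ('v set \<Rightarrow> int) \<Rightarrow> ('v set \<Rightarrow> int) \<Rightarrow>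
   ('v, 'e) mgraph \<Rightarrow> ('v, 'e) mgraph \<Rightarrow> bool" where
  "sparse_pair G f g H K \<longleftrightarrow>
     spanning_subgraph H G \<and> spanning_subgraph K G \<and> edges H \<inter> edges K = {} \<and>
     sparse f H \<and> sparse g K"

end

theory Submission
  imports Defs
begin

text \<open>This is a matroid-union argument. For a set function \<open>f\<close> put
  \<open>b X = (\<Sum>v\<in>X. f {v}) - f X\<close>, which is submodular on sufficiently intersecting sets; an \<open>f\<close>-sparse
  graph has at most \<open>b X\<close> edges inside \<open>X\<close>, and \<open>X\<close> is tight if equality holds. If an edge \<open>e\<close>
  cannot be added, the edges exchangeable with it are precisely those inside the smallest tight
  set containing \<open>e\<close>. Let \<open>D\<close> be the set of edges reachable from unused edges by exchanges. As the
  pair is maximum, no edge of \<open>D\<close> can be added to either graph, so each of them lies in a tight set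
  spanned by \<open>D\<close>. The maximal sets that are tight for \<open>F \<inter> D\<close> form the partition: all edges of \<open>D\<close> lie
  inside its parts, hence the tight sets of the second graph may be cut down to a part.\<close>

section \<open>Sparse edge sets and tight vertex sets\<close>

definition edges_inside :: "('e \<Rightarrow> 'v set) \<Rightarrow> 'e set \<Rightarrow> 'v set \<Rightarrow> 'e set" where
  "edges_inside en S X = {e \<in> S. en e \<subseteq> X}"

definition deficiency :: "('v set \<Rightarrow> int) \<Rightarrow> 'v set \<Rightarrow> int" where
  "deficiency f X = (\<Sum>v\<in>X. f {v}) - f X"

text \<open>With the vertices and the end map fixed, exchanges act on plain edge sets; graph records
  return only in the final translation.\<close>

locale edge_system =
  fixes V :: "'v set" and E :: "'e set" and en :: "'e \<Rightarrow> 'v set"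
  assumes finite_V: "finite V" and finite_E: "finite E"
    and ends_subset: "\<And>e. e \<in> E \<Longrightarrow> en e \<subseteq> V"
    and card_ends: "\<And>e. e \<in> E \<Longrightarrow> card (en e) = 2"
begin

abbreviation inside where "inside \<equiv> edges_inside en"

definition submod :: "nat \<Rightarrow> ('v set \<Rightarrow> int) \<Rightarrow> bool" where
  "submod c b \<longleftrightarrow> (\<forall>A B. A \<subseteq> V \<longrightarrow> B \<subseteq> V \<longrightarrow> c \<le> card (A \<inter> B) \<longrightarrow>
     b (A \<inter> B) + b (A \<union> B) \<le> b A + b B)"

text \<open>For \<open>b = deficiency f\<close> these are the edge sets of the
  \<open>f\<close>-sparse spanning subgraphs.\<close>

definition indep :: "('v set \<Rightarrow> int) \<Rightarrow> 'e set \<Rightarrow> bool" where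
  "indep b S \<longleftrightarrow> S \<subseteq> E \<and> (\<forall>X \<subseteq> V. int (card (inside S X)) \<le> b X)"

definition tight :: "('v set \<Rightarrow> int) \<Rightarrow> 'e set \<Rightarrow> 'v set \<Rightarrow> bool" where
  "tight b S X \<longleftrightarrow> X \<subseteq> V \<and> int (card (inside S X)) = b X"

text \<open>\<open>arrow b S e f\<close> says that \<open>f\<close> lies on the fundamental circuit of \<open>e\<close>; it holds for every
  \<open>f \<in> S\<close> if \<open>e\<close> can simply be added to \<open>S\<close>.\<close>

definition arrow :: "('v set \<Rightarrow> int) \<Rightarrow> 'e set \<Rightarrow> 'e \<Rightarrow> 'e \<Rightarrow> bool" where
  "arrow b S e f \<longleftrightarrow> e \<notin> S \<and> f \<in> S \<and> (\<forall>X. tight b S X \<longrightarrow> en e \<subseteq> X \<longrightarrow> en f \<subseteq> X)"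

text \<open>For independent \<open>S\<close> this means that \<open>insert e S\<close> is
  independent: only a tight set around \<open>e\<close> can become overfull.\<close>

definition addable :: "('v set \<Rightarrow> int) \<Rightarrow> 'e set \<Rightarrow> 'e \<Rightarrow> bool" where
  "addable b S e \<longleftrightarrow> e \<in> E \<and> e \<notin> S \<and> (\<forall>X. tight b S X \<longrightarrow> \<not> en e \<subseteq> X)"

lemma submod_mono: "submod c b \<Longrightarrow> c \<le> d \<Longrightarrow> submod d b"
  unfolding submod_def by (meson le_trans)

lemma indepD: "indep b S \<Longrightarrow> X \<subseteq> V \<Longrightarrow> int (card (inside S X)) \<le> b X"
  unfolding indep_def by blast

lemma indep_subset: "indep b S \<Longrightarrow> S \<subseteq> E"
  unfolding indep_def by blast

lemma finite_inside: "S \<subseteq> E \<Longrightarrow> finite (inside S X)"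
  unfolding edges_inside_def using finite_E by (auto intro: finite_subset)

lemma indep_mono:
  assumes "indep b S" "T \<subseteq> S"
  shows "indep b T"
  unfolding indep_def
proof (intro conjI allI impI)
  show "T \<subseteq> E" using assms indep_subset by blast
  fix X assume "X \<subseteq> V"
  have "inside T X \<subseteq> inside S X" using assms(2) by (auto simp: edges_inside_def)
  then have "card (inside T X) \<le> card (inside S X)"
    using finite_inside indep_subset[OF assms(1)] by (intro card_mono) auto
  then show "int (card (inside T X)) \<le> b X"
    using indepD[OF assms(1) \<open>X \<subseteq> V\<close>] by linarith
qed

text \<open>Sets containing both ends of a common edge meet in at least two vertices, so they can be
  uncrossed at threshold 2.\<close>

lemma card_ends_le: "e \<in> E \<Longrightarrow> en e \<subseteq> X \<Longrightarrow> X \<subseteq> V \<Longrightarrow> 2 \<le> card X"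
  using card_ends[of e] card_mono[of X "en e"] finite_V finite_subset by metis

section \<open>Uncrossing tight sets\<close>

text \<open>The third term counts the edges between \<open>A - B\<close> and \<open>B - A\<close>.
  Keeping it makes this an equality, from which the absence of such edges can be read off
  later.\<close>

lemma card_inside_supermodular:
  assumes "S \<subseteq> E"
  shows "card (inside S A) + card (inside S B) + card (inside S (A \<union> B) - (inside S A \<union> inside S B))
    = card (inside S (A \<union> B)) + card (inside S (A \<inter> B))"
proof -
  have "card (inside S A) + card (inside S B)
      = card (inside S A \<union> inside S B) + card (inside S A \<inter> inside S B)"
    by (rule card_Un_Int) (use assms finite_inside in auto)
  moreover have "inside S A \<inter> inside S B = inside S (A \<inter> B)"
    by (auto simp: edges_inside_def)
  moreover have sub: "inside S A \<union> inside S B \<subseteq> inside S (A \<union> B)"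
    by (auto simp: edges_inside_def)
  moreover have "card (inside S (A \<union> B) - (inside S A \<union> inside S B))
      = card (inside S (A \<union> B)) - card (inside S A \<union> inside S B)"
    using sub by (intro card_Diff_subset) (use assms finite_inside in auto)
  moreover have "card (inside S A \<union> inside S B) \<le> card (inside S (A \<union> B))"
    using sub by (intro card_mono) (use assms finite_inside in auto)
  ultimately show ?thesis by simp
qed

text \<open>Submodularity of \<open>b\<close> and supermodularity of the edge count squeeze each
  other, so every estimate is an equality and no edge joins \<open>A - B\<close> to
  \<open>B - A\<close>. The slack \<open>d\<close> is 0 for two tight sets and 1 when
  \<open>A\<close> is one edge short of tight.\<close>

lemma uncross_tight:
  assumes ind: "indep b S" and sm: "submod c b" and A: "A \<subseteq> V" and B: "tight b S B"
    and c: "c \<le> card (A \<inter> B)"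
    and d: "int (card (inside S A)) + d \<ge> b A"
      "int (card (inside S (A \<inter> B))) + d \<le> b (A \<inter> B)" "d \<ge> 0"
  shows "tight b S (A \<union> B)" "inside S (A \<union> B) = inside S A \<union> inside S B"
    "int (card (inside S (A \<inter> B))) + d = b (A \<inter> B)"
proof -
  have S: "S \<subseteq> E" using ind by (rule indep_subset)
  have BV: "B \<subseteq> V" using B by (simp add: tight_def)
  let ?D = "inside S (A \<union> B) - (inside S A \<union> inside S B)"
  have 1: "b (A \<inter> B) + b (A \<union> B) \<le> b A + b B"
    using sm A BV c by (simp add: submod_def)
  have 2: "int (card (inside S (A \<union> B))) \<le> b (A \<union> B)"
    by (rule indepD[OF ind]) (use A BV in auto)
  have 3: "int (card (inside S A)) + int (card (inside S B)) + int (card ?D)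
    = int (card (inside S (A \<union> B))) + int (card (inside S (A \<inter> B)))"
    using card_inside_supermodular[OF S, of A B] by linarith
  have 4: "int (card (inside S B)) = b B" using B by (simp add: tight_def)
  have "int (card (inside S (A \<union> B))) = b (A \<union> B)" and 5: "card ?D = 0"
    and "int (card (inside S (A \<inter> B))) + d = b (A \<inter> B)"
    using 1 2 3 4 d by linarith+
  then show "tight b S (A \<union> B)" "int (card (inside S (A \<inter> B))) + d = b (A \<inter> B)"
    using A BV by (auto simp: tight_def)
  have "?D = {}" using 5 finite_inside[OF S] by simp
  then show "inside S (A \<union> B) = inside S A \<union> inside S B"
    by (auto simp: edges_inside_def)
qed

lemma tight_Un_Int:
  assumes "indep b S" "submod c b" "tight b S A" "tight b S B" "c \<le> card (A \<inter> B)"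
  shows "tight b S (A \<union> B)" "tight b S (A \<inter> B)"
proof -
  have A: "A \<subseteq> V" "int (card (inside S A)) + 0 \<ge> b A" using assms(3) by (auto simp: tight_def)
  have I: "int (card (inside S (A \<inter> B))) + 0 \<le> b (A \<inter> B)"
    using indepD[OF assms(1), of "A \<inter> B"] A by auto
  note u = uncross_tight[OF assms(1,2) A(1) assms(4,5) A(2) I]
  show "tight b S (A \<union> B)" "tight b S (A \<inter> B)"
    using u A by (auto simp: tight_def)
qed

text \<open>Any two tight sets around \<open>e\<close> share its two ends, so their intersection is
  tight and a minimal one is the least. Its edges then lie in every tight set around
  \<open>e\<close>: they form the fundamental circuit of \<open>e\<close>, without
  \<open>e\<close>.\<close>

lemma ex_minimal_tight:
  assumes ind: "indep b S" and sm: "submod 2 b" and e: "e \<in> E" "e \<notin> S" "\<not> addable b S e"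
  obtains X where "tight b S X" "en e \<subseteq> X" "\<And>f. f \<in> inside S X \<longleftrightarrow> arrow b S e f"
proof -
  let ?M = "{X. tight b S X \<and> en e \<subseteq> X}"
  have "finite ?M"
    by (rule finite_subset[of _ "Pow V"]) (auto simp: tight_def finite_V)
  moreover have "?M \<noteq> {}" using e by (auto simp: addable_def)
  ultimately obtain X where X: "X \<in> ?M" "\<And>Y. Y \<in> ?M \<Longrightarrow> Y \<subseteq> X \<Longrightarrow> Y = X"
    using finite_has_minimal[of ?M] by (metis (no_types, lifting))
  have min: "X \<subseteq> Y" if Y: "tight b S Y" "en e \<subseteq> Y" for Y
  proof -
    have "2 \<le> card (X \<inter> Y)"
      by (rule card_ends_le[OF e(1)]) (use X(1) Y in \<open>auto simp: tight_def\<close>)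
    then have "tight b S (X \<inter> Y)" using tight_Un_Int(2)[OF ind sm _ Y(1)] X(1) by blast
    then have "X \<inter> Y = X" using X Y by blast
    then show ?thesis by blast
  qed
  show thesis
  proof (rule that)
    show "tight b S X" "en e \<subseteq> X" using X by auto
    fix f show "f \<in> inside S X \<longleftrightarrow> arrow b S e f"
      using min X(1) e(2) unfolding arrow_def edges_inside_def by blast
  qed
qed

section \<open>Exchanging one edge\<close>

lemma inside_insert:
  "inside (insert e S) X = (if en e \<subseteq> X then insert e (inside S X) else inside S X)"
  by (auto simp: edges_inside_def)

lemma inside_remove:
  "inside (S - {f}) X = (if en f \<subseteq> X then inside S X - {f} else inside S X)"
  by (auto simp: edges_inside_def)

lemma card_inside_exchange:
  assumes "S \<subseteq> E" "e \<notin> S" "f \<in> S"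
  shows "int (card (inside (insert e (S - {f})) X))
    = int (card (inside S X)) + of_bool (en e \<subseteq> X) - of_bool (en f \<subseteq> X)"
proof -
  have fin: "finite (inside S X)" using finite_inside assms(1) .
  have e: "e \<notin> inside S X" using assms(2) by (simp add: edges_inside_def)
  have "int (card (inside S X - {f})) = int (card (inside S X)) - 1" if "en f \<subseteq> X"
  proof -
    have "f \<in> inside S X" using that assms(3) by (simp add: edges_inside_def)
    then show ?thesis using fin by (metis card_Suc_Diff1 add_diff_cancel_left' of_nat_Suc)
  qed
  then show ?thesis
    using fin e by (simp add: inside_insert inside_remove)
qed

text \<open>The count grows only in sets that contain the ends of \<open>e\<close> but not those of
  \<open>f\<close>, and \<open>arrow\<close> says that none of these is tight.\<close>

lemma indep_exchange:
  assumes ind: "indep b S" and a: "arrow b S e f" and e: "e \<in> E"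
  shows "indep b (insert e (S - {f}))"
  unfolding indep_def
proof (intro conjI allI impI)
  have S: "S \<subseteq> E" using ind by (rule indep_subset)
  then show "insert e (S - {f}) \<subseteq> E" using e by auto
  fix X assume X: "X \<subseteq> V"
  have *: "int (card (inside S X)) \<le> b X" using indepD[OF ind X] .
  have "int (card (inside S X)) < b X" if "en e \<subseteq> X" "\<not> en f \<subseteq> X"
  proof -
    have "\<not> tight b S X" using a that by (auto simp: arrow_def)
    then show ?thesis using X * by (auto simp: tight_def)
  qed
  moreover have "int (card (inside (insert e (S - {f})) X))
      = int (card (inside S X)) + of_bool (en e \<subseteq> X) - of_bool (en f \<subseteq> X)"
    using card_inside_exchange[OF S] a by (simp add: arrow_def)
  ultimately show "int (card (inside (insert e (S - {f})) X)) \<le> b X"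
    using * by (cases "en e \<subseteq> X"; cases "en f \<subseteq> X") simp_all
qed

lemma indep_insert:
  assumes ind: "indep b S" and a: "addable b S e"
  shows "indep b (insert e S)"
  unfolding indep_def
proof (intro conjI allI impI)
  have S: "S \<subseteq> E" using ind by (rule indep_subset)
  then show "insert e S \<subseteq> E" using a by (auto simp: addable_def)
  fix X assume X: "X \<subseteq> V"
  have *: "int (card (inside S X)) \<le> b X" using indepD[OF ind X] .
  have "int (card (inside S X)) < b X" if "en e \<subseteq> X"
  proof -
    have "\<not> tight b S X" using a that by (auto simp: addable_def)
    then show ?thesis using X * by (auto simp: tight_def)
  qed
  moreover have "e \<notin> inside S X" using a by (simp add: addable_def edges_inside_def)
  ultimately show "int (card (inside (insert e S) X)) \<le> b X"
    using * finite_inside[OF S, of X] by (cases "en e \<subseteq> X") (simp_all add: inside_insert)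
qed

text \<open>If a set \<open>X\<close> became tight only through the exchange, it contains \<open>e\<close> but not \<open>f\<close>;
  uncrossing it with the minimal tight set around \<open>e\<close> then gives a set tight before the exchange.\<close>

lemma tight_after_exchange:
  assumes ind: "indep b S" and sm: "submod 2 b" and a: "arrow b S e f"
    and e: "e \<in> E" "\<not> addable b S e"
    and X: "tight b (insert e (S - {f})) X"
  obtains Z where "tight b S Z" "X \<subseteq> Z"
    "\<And>g. g \<in> inside S Z \<Longrightarrow> \<not> arrow b S e g \<Longrightarrow> en g \<subseteq> X"
proof -
  have S: "S \<subseteq> E" using ind by (rule indep_subset)
  have eS: "e \<notin> S" and fS: "f \<in> S" using a by (auto simp: arrow_def)
  have XV: "X \<subseteq> V" using X by (simp add: tight_def)
  have X': "int (card (inside S X)) + of_bool (en e \<subseteq> X) - of_bool (en f \<subseteq> X) = b X"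
    using X card_inside_exchange[OF S eS fS, of X] by (simp add: tight_def)
  show thesis
  proof (cases "en e \<subseteq> X \<and> \<not> en f \<subseteq> X")
    case False
    \<comment> \<open>The exchange leaves the count of \<open>X\<close> unchanged here: if
      \<open>X\<close> contained the ends of \<open>f\<close> but not of \<open>e\<close>, it would
      have held more than \<open>b X\<close> edges before.\<close>
    then have "tight b S X"
      using X' XV indepD[OF ind XV] by (auto simp: tight_def of_bool_def split: if_splits)
    then show thesis by (rule that) (auto simp: edges_inside_def)
  next
    case True
    obtain Y where Y: "tight b S Y" "en e \<subseteq> Y" "\<And>g. g \<in> inside S Y \<longleftrightarrow> arrow b S e g"
      using ex_minimal_tight[OF ind sm e(1) eS e(2)] by blast
    have c: "2 \<le> card (X \<inter> Y)"
      by (rule card_ends_le[OF e(1)]) (use True Y XV in auto)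
    \<comment> \<open>A tight \<open>X \<inter> Y\<close> around \<open>e\<close> would contain the
      ends of \<open>f\<close>. So the intersection has slack at least 1, matching the one edge that
      \<open>X\<close> lacked: uncrossing applies with \<open>d = 1\<close>.\<close>
    have "\<not> tight b S (X \<inter> Y)" using True Y(2) a by (auto simp: arrow_def)
    then have I: "int (card (inside S (X \<inter> Y))) + 1 \<le> b (X \<inter> Y)"
      using indepD[OF ind, of "X \<inter> Y"] XV by (force simp: tight_def)
    have 1: "int (card (inside S X)) + 1 \<ge> b X" using X' True by auto
    note u = uncross_tight[OF ind sm XV Y(1) c 1 I]
    show thesis
    proof (rule that)
      show "tight b S (X \<union> Y)" using u by simp
      \<comment> \<open>By uncrossing, \<open>g\<close> lies inside \<open>X\<close> or inside
        \<open>Y\<close>, and the edges inside \<open>Y\<close> are those on the circuit of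
        \<open>e\<close>.\<close>
      fix g assume "g \<in> inside S (X \<union> Y)" "\<not> arrow b S e g"
      then have "g \<in> inside S X" using u Y(3) by simp
      then show "en g \<subseteq> X" by (simp add: edges_inside_def)
    qed simp
  qed
qed

text \<open>A new tight set \<open>X\<close> around \<open>g\<close> extends to an old tight set
  \<open>Z\<close>, which contains the ends of \<open>h\<close>. As \<open>h\<close> is off the
  circuit of \<open>e\<close>, its ends already lie in \<open>X\<close>.\<close>

lemma arrow_after_exchange:
  assumes "indep b S" "submod 2 b" "arrow b S e f" "e \<in> E" "\<not> addable b S e"
    and "arrow b S g h" "\<not> arrow b S e h" "g \<noteq> e"
  shows "arrow b (insert e (S - {f})) g h"
  unfolding arrow_def
proof (intro conjI allI impI)
  show "g \<notin> insert e (S - {f})" using assms by (auto simp: arrow_def)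
  show "h \<in> insert e (S - {f})" using assms by (auto simp: arrow_def)
  fix X assume X: "tight b (insert e (S - {f})) X" "en g \<subseteq> X"
  obtain Z where Z: "tight b S Z" "X \<subseteq> Z"
    "\<And>k. k \<in> inside S Z \<Longrightarrow> \<not> arrow b S e k \<Longrightarrow> en k \<subseteq> X"
    using tight_after_exchange[OF assms(1-5) X(1)] by blast
  have "h \<in> inside S Z" using assms(6) Z X(2) by (auto simp: arrow_def edges_inside_def)
  then show "en h \<subseteq> X" using Z(3) assms(7) by blast
qed

text \<open>A new tight set around \<open>g\<close> would extend to an old one, which
  \<open>addable\<close> excludes.\<close>

lemma addable_after_exchange:
  assumes "indep b S" "submod 2 b" "arrow b S e f" "e \<in> E" "\<not> addable b S e"
    and "addable b S g" "g \<noteq> e"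
  shows "addable b (insert e (S - {f})) g"
  unfolding addable_def
proof (intro conjI allI impI notI)
  show "g \<in> E" using assms by (auto simp: addable_def)
  show "g \<in> insert e (S - {f}) \<Longrightarrow> False" using assms by (auto simp: addable_def)
  fix X assume X: "tight b (insert e (S - {f})) X" "en g \<subseteq> X"
  obtain Z where Z: "tight b S Z" "X \<subseteq> Z"
    by (rule tight_after_exchange[OF assms(1-5) X(1)])
  have "en g \<subseteq> Z" using X(2) Z(2) by (rule order_trans)
  then show False using assms(6) Z(1) by (simp add: addable_def)
qed

section \<open>Maximum pairs and augmenting walks\<close>

definition indep_pair where
  "indep_pair b c S T \<longleftrightarrow> indep b S \<and> indep c T \<and> S \<inter> T = {}"

definition max_pair where
  "max_pair b c S T \<longleftrightarrow> indep_pair b c S T \<and>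
     (\<forall>S' T'. indep_pair b c S' T' \<longrightarrow> card (S' \<union> T') \<le> card (S \<union> T))"

text \<open>The arcs of the exchange digraph of matroid union.\<close>

definition step where
  "step b c S T e f \<longleftrightarrow> arrow b S e f \<or> arrow c T e f"

lemma max_pair_commute: "max_pair b c S T \<Longrightarrow> max_pair c b T S"
  unfolding max_pair_def indep_pair_def by (metis Int_commute Un_commute)

lemma step_commute: "step b c S T = step c b T S"
  unfolding step_def by (intro ext) blast

lemma max_pair_not_addable:
  assumes "max_pair b c S T" "e \<in> E - (S \<union> T)"
  shows "\<not> addable b S e"
proof
  assume "addable b S e"
  then have "indep_pair b c (insert e S) T"
    using assms indep_insert by (auto simp: max_pair_def indep_pair_def)
  then have "card (insert e S \<union> T) \<le> card (S \<union> T)"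
    using assms(1) unfolding max_pair_def by blast
  moreover have "S \<union> T \<subseteq> E"
    using assms(1) by (auto simp: max_pair_def indep_pair_def indep_def)
  then have "finite (S \<union> T)" using finite_E finite_subset by blast
  ultimately show False using assms(2) by simp
qed

lemma max_pair_exchange:
  assumes m: "max_pair b c S T" and e: "e \<in> E - (S \<union> T)" and a: "arrow b S e f"
  shows "max_pair b c (insert e (S - {f})) T" "f \<in> E - (insert e (S - {f}) \<union> T)"
proof -
  have p: "indep b S" "indep c T" "S \<inter> T = {}"
    using m by (auto simp: max_pair_def indep_pair_def)
  have f: "f \<in> S" using a by (simp add: arrow_def)
  have "indep_pair b c (insert e (S - {f})) T"
    using p indep_exchange[OF p(1) a] e by (auto simp: indep_pair_def)
  moreover have "S \<union> T \<subseteq> E" using p by (auto simp: indep_def)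
  then have "finite (S \<union> T)" using finite_E finite_subset by blast
  then have "card (insert e ((S \<union> T) - {f})) = card (S \<union> T)"
    using e f card_Suc_Diff1[of "S \<union> T" f] by simp
  moreover have "insert e (S - {f}) \<union> T = insert e ((S \<union> T) - {f})" using p f by auto
  ultimately show "max_pair b c (insert e (S - {f})) T"
    using m by (simp add: max_pair_def)
  show "f \<in> E - (insert e (S - {f}) \<union> T)" using p f e by (auto simp: indep_def)
qed

text \<open>Augmenting paths do not exist. A walk with a shortcut from its first vertex is replaced by
  a shorter one; otherwise performing the first exchange preserves the remainder of the walk.\<close>

lemma no_augmenting_walk:
  assumes "submod 2 b" "submod 2 c"
  shows "max_pair b c S T \<Longrightarrow> w 0 \<in> E - (S \<union> T) \<Longrightarrow> (\<forall>i<n. step b c S T (w i) (w (Suc i)))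
    \<Longrightarrow> \<not> addable b S (w n) \<and> \<not> addable c T (w n)"
  using assms
proof (induction n arbitrary: b c S T w rule: less_induct)
  case (less n)
  note m = less.prems(1) and w0 = less.prems(2) and w = less.prems(3) and sm = less.prems(4,5)
  show ?case
  proof (cases n)
    case 0
    then show ?thesis
      using max_pair_not_addable[OF m w0] max_pair_not_addable[OF max_pair_commute[OF m]] w0
      by auto
  next
    case (Suc k)
    show ?thesis
    proof (cases "\<exists>j. 2 \<le> j \<and> j \<le> n \<and> step b c S T (w 0) (w j)")
      case True
      then obtain j where j: "2 \<le> j" "j \<le> n" "step b c S T (w 0) (w j)" by blast
      \<comment> \<open>The walk jumps from \<open>w 0\<close> to \<open>w j\<close>, so
        \<open>u (Suc i) = w (i + j)\<close>. It has \<open>n - j + 1\<close> steps, fewer than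
        \<open>n\<close> because \<open>j\<close> is at least 2.\<close>
      define u where "u i = (if i = 0 then w 0 else w (i + j - 1))" for i
      have "\<not> addable b S (u (n - j + 1)) \<and> \<not> addable c T (u (n - j + 1))"
      proof (rule less.IH[OF _ m _ _ sm])
        show "n - j + 1 < n" using j by simp
        show "u 0 \<in> E - (S \<union> T)" using w0 by (simp add: u_def)
        show "\<forall>i<n - j + 1. step b c S T (u i) (u (Suc i))"
        proof (intro allI impI)
          fix i assume i: "i < n - j + 1"
          show "step b c S T (u i) (u (Suc i))"
          proof (cases "i = 0")
            case True
            then show ?thesis using j by (simp add: u_def)
          next
            case False
            then have "i + j - 1 < n" using i j by linarith
            moreover have "Suc (i + j - 1) = Suc i + j - 1" using False by linarith
            ultimately have "step b c S T (w (i + j - 1)) (w (Suc i + j - 1))" using w by metis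
            then show ?thesis using False by (simp add: u_def)
          qed
        qed
      qed
      moreover have "u (n - j + 1) = w n" using j by (simp add: u_def)
      ultimately show ?thesis by simp
    next
      case False
      \<comment> \<open>The first arrow may belong to either edge set; the primed copies allow both
        roles to be treated at once.\<close>
      have main: "\<not> addable b' S' (w n) \<and> \<not> addable c' T' (w n)"
        if a: "arrow b' S' (w 0) (w 1)" and st: "step b' c' S' T' = step b c S T"
          and m': "max_pair b' c' S' T'" and sm': "submod 2 b'" "submod 2 c'"
          and ST: "S' \<union> T' = S \<union> T" for b' c' S' T'
      proof -
        let ?S = "insert (w 0) (S' - {w 1})"
        have w0': "w 0 \<in> E - (S' \<union> T')" using w0 ST by simp
        note ex = max_pair_exchange[OF m' w0' a]
        have p: "indep b' S'" using m' by (simp add: max_pair_def indep_pair_def)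
        have na: "\<not> addable b' S' (w 0)" using max_pair_not_addable[OF m' w0'] .
        have mem: "w (Suc i) \<in> S' \<union> T'" if "i < n" for i
        proof -
          have "step b' c' S' T' (w i) (w (Suc i))" using w that st by simp
          then show ?thesis by (auto simp: step_def arrow_def)
        qed
        then have ne: "w (Suc i) \<noteq> w 0" if "i < n" for i using w0' that by fastforce
        have "\<not> addable b' ?S (w (Suc k)) \<and> \<not> addable c' T' (w (Suc k))"
        proof (rule less.IH[of k b' c' ?S T' "\<lambda>i. w (Suc i)", OF _ ex(1) _ _ sm'])
          show "k < n" using Suc by simp
          show "w (Suc 0) \<in> E - (?S \<union> T')" using ex(2) by simp
          show "\<forall>i<k. step b' c' ?S T' (w (Suc i)) (w (Suc (Suc i)))"
          proof (intro allI impI)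
            fix i assume i: "i < k"
            then have s: "step b' c' S' T' (w (Suc i)) (w (Suc (Suc i)))"
              using w st Suc by simp
            \<comment> \<open>The absence of shortcuts says that later heads are off the circuit of
              \<open>w 0\<close>, as preserving an arrow requires.\<close>
            have "\<not> step b' c' S' T' (w 0) (w (Suc (Suc i)))" using False st i Suc by simp
            then have "\<not> arrow b' S' (w 0) (w (Suc (Suc i)))" by (simp add: step_def)
            moreover have "w (Suc i) \<noteq> w 0" using ne i Suc by simp
            ultimately show "step b' c' ?S T' (w (Suc i)) (w (Suc (Suc i)))"
              using s arrow_after_exchange[OF p sm'(1) a _ na] w0' by (auto simp: step_def)
          qed
        qed
        \<comment> \<open>If \<open>w n\<close> were addable before the exchange, it would remain
          addable after it.\<close>
        moreover have "w n \<noteq> w 0" using ne Suc by simp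
        ultimately show ?thesis
          using addable_after_exchange[OF p sm'(1) a _ na] w0' Suc by auto
      qed
      have "step b c S T (w 0) (w 1)" using w Suc by auto
      then show ?thesis
        unfolding step_def
      proof
        assume "arrow b S (w 0) (w 1)"
        then show ?thesis using main[of b S c T] m sm by blast
      next
        assume "arrow c T (w 0) (w 1)"
        then show ?thesis
          using main[of c T b S] max_pair_commute[OF m] sm step_commute[of c b T S] by blast
      qed
    qed
  qed
qed

section \<open>Edges reachable by exchanges\<close>

definition reach where
  "reach b c S T = {f. \<exists>e \<in> E - (S \<union> T). (step b c S T)\<^sup>*\<^sup>* e f}"

lemma reach_commute: "reach b c S T = reach c b T S"
  unfolding reach_def using step_commute[of b c S T] by (auto simp: Un_commute)

lemma reach_step: "e \<in> reach b c S T \<Longrightarrow> step b c S T e f \<Longrightarrow> f \<in> reach b c S T"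
  unfolding reach_def by (auto intro: rtranclp.rtrancl_into_rtrancl)

lemma reach_subset:
  assumes "S \<subseteq> E" "T \<subseteq> E"
  shows "reach b c S T \<subseteq> E"
proof
  fix f assume "f \<in> reach b c S T"
  then obtain e where "e \<in> E" "(step b c S T)\<^sup>*\<^sup>* e f" by (auto simp: reach_def)
  from this(2,1) show "f \<in> E"
    by (induction rule: rtranclp_induct) (use assms in \<open>auto simp: step_def arrow_def\<close>)
qed

lemma reach_not_addable:
  assumes "submod 2 b" "submod 2 c" "max_pair b c S T" "f \<in> reach b c S T"
  shows "\<not> addable b S f"
proof -
  obtain e where e: "e \<in> E - (S \<union> T)" "(step b c S T)\<^sup>*\<^sup>* e f"
    using assms(4) by (auto simp: reach_def)
  then obtain n where "(step b c S T ^^ n) e f" by (auto dest: rtranclp_imp_relpowp)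
  then obtain w where "w 0 = e" "w n = f" "\<forall>i<n. step b c S T (w i) (w (Suc i))"
    by (auto simp: relpowp_fun_conv)
  then show ?thesis using no_augmenting_walk[OF assms(1-3), of w n] e by auto
qed

text \<open>As \<open>e\<close> is not addable, it has a least tight set. The edges of
  \<open>S\<close> inside that set are one step from \<open>e\<close>, hence reachable as
  well.\<close>

lemma reach_tight:
  assumes "submod 2 b" "submod 2 c" "max_pair b c S T" "e \<in> reach b c S T" "e \<notin> S"
  obtains X where "tight b S X" "en e \<subseteq> X" "inside S X \<subseteq> reach b c S T"
    "\<And>f. f \<in> inside S X \<longleftrightarrow> arrow b S e f"
proof -
  have p: "indep b S" "S \<subseteq> E" "T \<subseteq> E"
    using assms(3) by (auto simp: max_pair_def indep_pair_def indep_def)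
  have "e \<in> E" using assms(4) reach_subset p by blast
  then obtain X where X: "tight b S X" "en e \<subseteq> X" "\<And>f. f \<in> inside S X \<longleftrightarrow> arrow b S e f"
    using ex_minimal_tight[OF p(1) assms(1) _ assms(5)] reach_not_addable[OF assms(1-4)] by blast
  have "inside S X \<subseteq> reach b c S T"
    using X(3) reach_step[OF assms(4)] by (auto simp: step_def)
  then show thesis using that X by blast
qed

lemma reach_inside_tight:
  assumes sm: "submod 2 b" "submod 2 c" and m: "max_pair b c S T" and f: "f \<in> reach b c S T"
  obtains X where "tight b (reach b c S T \<inter> S) X" "en f \<subseteq> X"
proof -
  let ?D = "reach b c S T"
  \<comment> \<open>Discarding unreachable edges leaves the count inside such an \<open>X\<close>
    unchanged.\<close>
  have restrict: "tight b (?D \<inter> S) X" if "tight b S X" "inside S X \<subseteq> ?D" for X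
  proof -
    have "inside (?D \<inter> S) X = inside S X" using that(2) by (auto simp: edges_inside_def)
    then show ?thesis using that(1) by (simp add: tight_def)
  qed
  show thesis
  proof (cases "f \<in> S")
    case False
    then show thesis using reach_tight[OF sm m f] restrict that by metis
  next
    case True
    obtain e where e: "e \<in> E - (S \<union> T)" "(step b c S T)\<^sup>*\<^sup>* e f"
      using f by (auto simp: reach_def)
    moreover have "e \<noteq> f" using e True by blast
    ultimately obtain g where g: "(step b c S T)\<^sup>*\<^sup>* e g" "step b c S T g f"
      by (metis rtranclp.cases)
    then have gD: "g \<in> ?D" using e by (auto simp: reach_def)
    have a: "arrow b S g f"
      using g(2) True m by (auto simp: step_def arrow_def max_pair_def indep_pair_def)
    then have "g \<notin> S" by (simp add: arrow_def)
    then obtain X where "tight b S X" "inside S X \<subseteq> ?D" "f \<in> inside S X"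
      using reach_tight[OF sm m gD] a by metis
    then show thesis using restrict that by (auto simp: edges_inside_def)
  qed
qed

section \<open>The partition into maximal tight sets\<close>

definition blocks :: "('v set \<Rightarrow> int) \<Rightarrow> 'e set \<Rightarrow> 'v set set" where
  "blocks b S = {A. A \<noteq> {} \<and> tight b S A \<and> (\<forall>B. tight b S B \<longrightarrow> A \<subseteq> B \<longrightarrow> B = A)}"

lemma tight_subset_block:
  assumes "tight b S X" "X \<noteq> {}"
  obtains A where "A \<in> blocks b S" "X \<subseteq> A"
proof -
  let ?M = "{Y. tight b S Y}"
  have "finite ?M"
    by (rule finite_subset[of _ "Pow V"]) (auto simp: tight_def finite_V)
  then obtain A where "A \<in> ?M" "X \<subseteq> A" "\<forall>B\<in>?M. A \<subseteq> B \<longrightarrow> A = B"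
    using finite_has_maximal2[of ?M X] assms(1) by blast
  then show thesis using that[of A] assms by (auto simp: blocks_def)
qed

text \<open>At threshold 1, tight sets that meet have a tight union, so maximal ones are disjoint.
  They cover \<open>V\<close> because singletons span no edge and have \<open>b {v} = 0\<close>,
  hence are tight.\<close>

lemma partition_on_blocks:
  assumes ind: "indep b S" and sm: "submod 1 b" and sing: "\<And>v. v \<in> V \<Longrightarrow> b {v} = 0"
  shows "partition_on V (blocks b S)"
proof (rule partition_onI)
  show "{} \<notin> blocks b S" by (simp add: blocks_def)
  show "disjnt A B" if AB: "A \<in> blocks b S" "B \<in> blocks b S" "A \<noteq> B" for A B
  proof (rule ccontr)
    assume "\<not> disjnt A B"
    then have "A \<inter> B \<noteq> {}" by (simp add: disjnt_def)
    moreover have "finite (A \<inter> B)"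
      using AB finite_V by (auto simp: blocks_def tight_def intro: finite_subset)
    ultimately have "1 \<le> card (A \<inter> B)" by (simp add: Suc_le_eq card_gt_0_iff)
    then have "tight b S (A \<union> B)"
      using tight_Un_Int(1)[OF ind sm] AB by (auto simp: blocks_def)
    then have "A \<union> B = A" "A \<union> B = B" using AB by (auto simp: blocks_def)
    then show False using AB(3) by simp
  qed
  show "\<Union> (blocks b S) = V"
  proof
    show "\<Union> (blocks b S) \<subseteq> V" by (auto simp: blocks_def tight_def)
    show "V \<subseteq> \<Union> (blocks b S)"
    proof
      fix v assume v: "v \<in> V"
      have "inside S {v} = {}"
      proof -
        have "\<not> en e \<subseteq> {v}" if "e \<in> S" for e
          using that ind card_ends_le[of e "{v}"] v by (auto simp: indep_def)
        then show ?thesis by (auto simp: edges_inside_def)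
      qed
      then have "tight b S {v}" using v sing by (simp add: tight_def)
      then obtain A where "A \<in> blocks b S" "{v} \<subseteq> A" using tight_subset_block by blast
      then show "v \<in> \<Union> (blocks b S)" by blast
    qed
  qed
qed

text \<open>Cutting \<open>Y\<close> along \<open>A\<close> loses no edge, while the bounds of the
  two pieces add up to at most \<open>b Y\<close>; hence both pieces must be full.\<close>

lemma tight_inter_uncrossed:
  assumes ind: "indep b S" and Y: "tight b S Y"
    and super: "b (Y \<inter> A) + b (Y - A) \<le> b Y"
    and unc: "\<And>e. e \<in> inside S Y \<Longrightarrow> en e \<subseteq> A \<or> en e \<inter> A = {}"
  shows "tight b S (Y \<inter> A)"
proof -
  have S: "S \<subseteq> E" using ind by (rule indep_subset)
  have V: "Y \<inter> A \<subseteq> V" "Y - A \<subseteq> V" using Y by (auto simp: tight_def)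
  have "inside S Y = inside S (Y \<inter> A) \<union> inside S (Y - A)"
    using unc by (auto simp: edges_inside_def)
  then have "card (inside S Y) \<le> card (inside S (Y \<inter> A)) + card (inside S (Y - A))"
    by (simp add: card_Un_le)
  then show ?thesis
    using indepD[OF ind V(1)] indepD[OF ind V(2)] Y super V by (auto simp: tight_def)
qed

text \<open>The theorem in terms of tightness, which later yields partition-connectivity for
  \<open>S\<close> and rigidity for \<open>T\<close>.\<close>

lemma max_pair_partition:
  assumes m: "max_pair b c S T" and smb: "submod 1 b" and smc: "submod 2 c"
    and sing: "\<And>v. v \<in> V \<Longrightarrow> b {v} = 0"
    and super: "\<And>X Y. X \<subseteq> V \<Longrightarrow> Y \<subseteq> V \<Longrightarrow> X \<inter> Y = {} \<Longrightarrow> c X + c Y \<le> c (X \<union> Y)"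
  obtains P where "partition_on V P" "\<And>A. A \<in> P \<Longrightarrow> tight b S A"
    "\<And>e. e \<in> E - (S \<union> T) \<Longrightarrow> \<exists>A\<in>P. en e \<subseteq> A"
    "\<And>e A. e \<in> E - T \<Longrightarrow> A \<in> P \<Longrightarrow> en e \<subseteq> A \<Longrightarrow> \<exists>X. en e \<subseteq> X \<and> X \<subseteq> A \<and> tight c T X"
proof -
  let ?D = "reach b c S T"
  let ?P = "blocks b (?D \<inter> S)"
  have smb2: "submod 2 b" using submod_mono[OF smb] by simp
  have ind: "indep b S" "indep c T" "S \<subseteq> E" "T \<subseteq> E"
    using m by (auto simp: max_pair_def indep_pair_def indep_def)
  have indD: "indep b (?D \<inter> S)" using indep_mono[OF ind(1)] by simp
  have part: "partition_on V ?P" by (rule partition_on_blocks[OF indD smb sing])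
  have D: "\<exists>A\<in>?P. en e \<subseteq> A" if e: "e \<in> ?D" for e
  proof -
    obtain X where X: "tight b (?D \<inter> S) X" "en e \<subseteq> X"
      using reach_inside_tight[OF smb2 smc m e] by blast
    have "e \<in> E" using e reach_subset ind by blast
    then have "X \<noteq> {}" using X(2) card_ends[of e] by auto
    then show ?thesis using tight_subset_block[OF X(1)] X(2) by (metis order_trans)
  qed
  have tightP: "tight b S A \<and> inside S A \<subseteq> ?D" if A: "A \<in> ?P" for A
  proof -
    have t: "tight b (?D \<inter> S) A" using A by (simp add: blocks_def)
    have sub: "inside (?D \<inter> S) A \<subseteq> inside S A" by (auto simp: edges_inside_def)
    have fin: "finite (inside S A)" using finite_inside ind by blast
    have le: "int (card (inside S A)) \<le> b A" using indepD[OF ind(1)] t by (simp add: tight_def)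
    \<comment> \<open>The reachable edges already fill the bound \<open>b A\<close>, so the rest of
      \<open>S\<close> contributes no edge inside \<open>A\<close>.\<close>
    then have "card (inside S A) \<le> card (inside (?D \<inter> S) A)" using t by (simp add: tight_def)
    then have "inside (?D \<inter> S) A = inside S A" using card_seteq[OF fin sub] by simp
    then show ?thesis using t by (auto simp: tight_def edges_inside_def)
  qed
  have unused: "E - (S \<union> T) \<subseteq> ?D" by (auto simp: reach_def)
  have inner: "\<exists>X. en e \<subseteq> X \<and> X \<subseteq> A \<and> tight c T X" if e: "e \<in> E - T" and A: "A \<in> ?P" "en e \<subseteq> A" for e A
  proof -
    have eD: "e \<in> ?D"
      using unused tightP[OF A(1)] e A(2) by (auto simp: edges_inside_def)
    then have eD': "e \<in> reach c b T S" using reach_commute by metis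
    have "e \<notin> T" using e by simp
    obtain Y where Y: "tight c T Y" "en e \<subseteq> Y" "inside T Y \<subseteq> reach c b T S"
      by (rule reach_tight[OF smc smb2 max_pair_commute[OF m] eD' \<open>e \<notin> T\<close>])
    \<comment> \<open>\<open>Y\<close> and \<open>A\<close> are tight for different functions, so
      they are not uncrossed; instead \<open>Y\<close> is cut along \<open>A\<close>. Its edges of
      \<open>T\<close> are reachable, so each lies inside one part and none crosses the cut.\<close>
    have "tight c T (Y \<inter> A)"
    proof (rule tight_inter_uncrossed[OF ind(2) Y(1)])
      have "c (Y \<inter> A) + c (Y - A) \<le> c ((Y \<inter> A) \<union> (Y - A))"
        by (rule super) (use Y(1) in \<open>auto simp: tight_def\<close>)
      then show "c (Y \<inter> A) + c (Y - A) \<le> c Y" by (simp add: Un_commute Un_Diff_Int)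
      fix f assume "f \<in> inside T Y"
      then have "f \<in> ?D" using Y(3) reach_commute by blast
      then obtain B where B: "B \<in> ?P" "en f \<subseteq> B" using D by blast
      show "en f \<subseteq> A \<or> en f \<inter> A = {}"
      proof (cases "A = B")
        case False
        then have "A \<inter> B = {}" using part A(1) B(1) by (auto simp: partition_on_def disjoint_def)
        then show ?thesis using B by blast
      qed (use B in simp)
    qed
    then show ?thesis using Y(2) A(2) by (intro exI[of _ "Y \<inter> A"]) simp
  qed
  show thesis
  proof (rule that[OF part])
    show "tight b S A" if "A \<in> ?P" for A using tightP[OF that] by simp
    show "\<exists>A\<in>?P. en e \<subseteq> A" if "e \<in> E - (S \<union> T)" for e using D unused that by blast
  qed (rule inner)
qed

end

section \<open>Translation to sparse, rigid and partition-connected graphs\<close>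

lemma deficiency_submodular:
  assumes "finite V" "intersecting_supermodular c V f" "A \<subseteq> V" "B \<subseteq> V" "c \<le> card (A \<inter> B)"
  shows "deficiency f (A \<inter> B) + deficiency f (A \<union> B) \<le> deficiency f A + deficiency f B"
proof -
  have "finite A" "finite B" using assms finite_subset by blast+
  then have "(\<Sum>v\<in>A \<union> B. f {v}) + (\<Sum>v\<in>A \<inter> B. f {v}) = (\<Sum>v\<in>A. f {v}) + (\<Sum>v\<in>B. f {v})"
    by (rule sum.union_inter)
  moreover have "f A + f B \<le> f (A \<inter> B) + f (A \<union> B)"
    using assms by (simp add: intersecting_supermodular_def)
  ultimately show ?thesis by (simp add: deficiency_def)
qed

lemma deficiency_superadditive:
  assumes "finite V" "subadditive_on V f" "A \<subseteq> V" "B \<subseteq> V" "A \<inter> B = {}"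
  shows "deficiency f A + deficiency f B \<le> deficiency f (A \<union> B)"
proof -
  have "finite A" "finite B" using assms finite_subset by blast+
  then have "(\<Sum>v\<in>A \<union> B. f {v}) = (\<Sum>v\<in>A. f {v}) + (\<Sum>v\<in>B. f {v})"
    using assms(5) by (rule sum.union_disjoint)
  moreover have "f (A \<union> B) \<le> f A + f B"
    using assms by (simp add: subadditive_on_def)
  ultimately show ?thesis by (simp add: deficiency_def)
qed

lemma edges_in_eq:
  assumes "\<And>e. e \<in> edges H \<Longrightarrow> ends H e = en e"
  shows "edges_in H X = card (edges_inside en (edges H) X)"
proof -
  have "{e \<in> edges H. ends H e \<subseteq> X} = {e \<in> edges H. en e \<subseteq> X}" using assms by auto
  then show ?thesis by (simp add: edges_in_def edges_inside_def)
qed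

lemma sparse_iff_deficiency:
  "sparse f H \<longleftrightarrow> (\<forall>X\<subseteq>verts H. int (edges_in H X) \<le> deficiency f X)"
  by (simp add: sparse_def deficiency_def)

lemma sparse_induced_subgraph:
  assumes "sparse f H" "X \<subseteq> verts H"
  shows "sparse f (induced_subgraph H X)"
proof -
  have "edges_in (induced_subgraph H X) Y = edges_in H Y" if "Y \<subseteq> X" for Y
  proof -
    have "{e \<in> edges H. ends H e \<subseteq> X \<and> ends H e \<subseteq> Y} = {e \<in> edges H. ends H e \<subseteq> Y}"
      using that by blast
    then show ?thesis by (simp add: edges_in_def induced_subgraph_def)
  qed
  then show ?thesis
    using assms by (auto simp: sparse_def induced_subgraph_def)
qed

text \<open>The induced subgraph is its own sparse witness.\<close>

lemma rigid_induced_subgraph: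
  assumes "sparse f H" "X \<subseteq> verts H" "int (edges_in H X) = deficiency f X"
  shows "rigid f (induced_subgraph H X)"
  unfolding rigid_def
proof (intro exI conjI)
  let ?K = "induced_subgraph H X"
  show "spanning_subgraph ?K ?K" by (simp add: spanning_subgraph_def)
  show "sparse f ?K" using sparse_induced_subgraph assms by blast
  show "int (card (edges ?K)) = (\<Sum>v\<in>verts ?K. f {v}) - f (verts ?K)"
    using assms(3) by (simp add: induced_subgraph_def edges_in_def deficiency_def)
qed

text \<open>Each edge inside \<open>A\<close> lies inside a part or crosses, and sparsity bounds the
  former by the deficiencies of the parts. The singleton sums over the parts add up to that over
  \<open>A\<close> and cancel against the tightness of \<open>A\<close>.\<close>

lemma partition_connected_induced_subgraph:
  assumes sp: "sparse f H" and A: "A \<subseteq> verts H" "finite A" and fin: "finite (edges H)"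
    and two: "\<And>e. e \<in> edges H \<Longrightarrow> card (ends H e) = 2"
    and t: "int (edges_in H A) = deficiency f A"
  shows "partition_connected f (induced_subgraph H A)"
  unfolding partition_connected_def
proof (intro allI impI)
  let ?K = "induced_subgraph H A"
  fix Q assume "partition_on (verts ?K) Q"
  then have Q: "partition_on A Q" by (simp add: induced_subgraph_def)
  then have UQ: "\<Union>Q = A" by (auto simp: partition_on_def)
  have finQ: "finite Q" using Q A(2) finite_elements by blast
  let ?in = "\<lambda>B. {e \<in> edges H. ends H e \<subseteq> B}"
  let ?across = "{e \<in> edges ?K. joins_parts ?K Q e}"
  have sub: "?in A \<subseteq> (\<Union>B\<in>Q. ?in B) \<union> ?across"
  proof
    fix e assume e: "e \<in> ?in A"
    then have "card (ends H e) = 2" using two by blast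
    then obtain x y where xy: "ends H e = {x, y}" by (auto simp: card_2_iff)
    then obtain B C where BC: "B \<in> Q" "C \<in> Q" "x \<in> B" "y \<in> C" using e UQ by auto
    show "e \<in> (\<Union>B\<in>Q. ?in B) \<union> ?across"
    proof (cases "B = C")
      case True
      then have "e \<in> ?in B" using e xy BC by simp
      then show ?thesis using BC(1) by blast
    next
      case False
      then have "joins_parts ?K Q e"
        unfolding joins_parts_def using xy BC by (simp add: induced_subgraph_def) blast
      then show ?thesis using e by (simp add: induced_subgraph_def)
    qed
  qed
  have "edges_in H A \<le> card ((\<Union>B\<in>Q. ?in B) \<union> ?across)"
    unfolding edges_in_def
    by (rule card_mono[OF _ sub]) (use fin finQ in \<open>auto simp: induced_subgraph_def\<close>)
  also have "\<dots> \<le> card (\<Union>B\<in>Q. ?in B) + card ?across" by (rule card_Un_le)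
  also have "card (\<Union>B\<in>Q. ?in B) \<le> (\<Sum>B\<in>Q. edges_in H B)"
    unfolding edges_in_def by (rule card_UN_le[OF finQ])
  finally have "int (edges_in H A) \<le> (\<Sum>B\<in>Q. int (edges_in H B)) + int (edges_across ?K Q)"
    by (simp add: edges_across_def flip: of_nat_sum of_nat_add)
  also have "(\<Sum>B\<in>Q. int (edges_in H B)) \<le> (\<Sum>B\<in>Q. deficiency f B)"
    using sp UQ A(1) by (intro sum_mono) (auto simp: sparse_iff_deficiency)
  also have "\<dots> = (\<Sum>B\<in>Q. \<Sum>v\<in>B. f {v}) - (\<Sum>B\<in>Q. f B)"
    by (simp add: deficiency_def sum_subtractf)
  also have "(\<Sum>B\<in>Q. \<Sum>v\<in>B. f {v}) = (\<Sum>v\<in>A. f {v})"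
    using sum.partition[OF A(2) Q, of "\<lambda>v. f {v}"] by simp
  finally show "int (edges_across ?K Q) \<ge> (\<Sum>B\<in>Q. f B) - f (verts ?K)"
    using t by (simp add: deficiency_def induced_subgraph_def)
qed

theorem theorem5p1:
  fixes G F FF :: "('v, 'e) mgraph"
    and l ell :: "'v set \<Rightarrow> int"
  assumes "multigraph G"
    and "l {} = 0"
    and "intersecting_supermodular 1 (verts G) l"
    and "subadditive_on (verts G) l"
    and "ell {} = 0"
    and "intersecting_supermodular 2 (verts G) ell"
    and "subadditive_on (verts G) ell"
    and "sparse_pair G l ell F FF"
    and "\<And>F' FF'. sparse_pair G l ell F' FF' \<Longrightarrow>
           card (edges F' \<union> edges FF') \<le> card (edges F \<union> edges FF)"
  shows "\<exists>P. partition_on (verts G) P \<and>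
    (\<forall>A \<in> P. partition_connected l (induced_subgraph F A)) \<and>
    (\<forall>e \<in> edges G - (edges F \<union> edges FF). \<not> joins_parts G P e) \<and>
    (\<forall>e \<in> edges G - edges FF. \<forall>x y. \<forall>A \<in> P. ends G e = {x, y} \<and> x \<in> A \<and> y \<in> A \<longrightarrow>
       (\<exists>X. {x, y} \<subseteq> X \<and> X \<subseteq> A \<and> rigid ell (induced_subgraph FF X)))"
proof -
  have finV: "finite (verts G)" using assms(1) by (simp add: multigraph_def)
  interpret edge_system "verts G" "edges G" "ends G"
    by unfold_locales (use assms(1) in \<open>auto simp: multigraph_def\<close>)
  have sF: "spanning_subgraph F G" "spanning_subgraph FF G" "sparse l F" "sparse ell FF"
    and disj: "edges F \<inter> edges FF = {}"
    using assms(8) by (auto simp: sparse_pair_def)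
  have in_eq: "edges_in H X = card (inside (edges H) X)" if "spanning_subgraph H G" for H X
    by (rule edges_in_eq) (use that in \<open>auto simp: spanning_subgraph_def\<close>)
  have indep_iff: "indep (deficiency f) (edges H) \<longleftrightarrow> sparse f H" if "spanning_subgraph H G" for f H
    using that in_eq[OF that] by (auto simp: indep_def sparse_iff_deficiency spanning_subgraph_def)
  \<comment> \<open>Independent edge sets are turned back into graphs, so that the assumed
    maximality covers every independent pair.\<close>
  let ?H = "\<lambda>S. \<lparr>verts = verts G, edges = S, ends = ends G\<rparr>"
  have m: "max_pair (deficiency l) (deficiency ell) (edges F) (edges FF)"
    unfolding max_pair_def
  proof (intro conjI allI impI)
    show "indep_pair (deficiency l) (deficiency ell) (edges F) (edges FF)"
      using indep_iff sF disj by (simp add: indep_pair_def)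
    fix S T assume ST: "indep_pair (deficiency l) (deficiency ell) S T"
    then have sub: "spanning_subgraph (?H S) G" "spanning_subgraph (?H T) G"
      by (auto simp: indep_pair_def indep_def spanning_subgraph_def)
    have "sparse_pair G l ell (?H S) (?H T)"
      using sub ST indep_iff[OF sub(1), of l] indep_iff[OF sub(2), of ell]
      by (simp add: sparse_pair_def indep_pair_def)
    from assms(9)[OF this] show "card (S \<union> T) \<le> card (edges F \<union> edges FF)" by simp
  qed
  have sm: "submod 1 (deficiency l)" "submod 2 (deficiency ell)"
    unfolding submod_def using deficiency_submodular[OF finV] assms(3,6) by blast+
  \<comment> \<open>The deficiency vanishes on singletons, and subadditivity of \<open>ell\<close>
    becomes superadditivity of its deficiency.\<close>
  obtain P where P: "partition_on (verts G) P"
    "\<And>A. A \<in> P \<Longrightarrow> tight (deficiency l) (edges F) A"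
    "\<And>e. e \<in> edges G - (edges F \<union> edges FF) \<Longrightarrow> \<exists>A\<in>P. ends G e \<subseteq> A"
    "\<And>e A. e \<in> edges G - edges FF \<Longrightarrow> A \<in> P \<Longrightarrow> ends G e \<subseteq> A \<Longrightarrow>
      \<exists>X. ends G e \<subseteq> X \<and> X \<subseteq> A \<and> tight (deficiency ell) (edges FF) X"
    using max_pair_partition[OF m sm] deficiency_superadditive[OF finV assms(7)]
    by (auto simp: deficiency_def)
  show ?thesis
  proof (intro exI[of _ P] conjI ballI allI impI)
    show "partition_on (verts G) P" by (rule P)
    show "partition_connected l (induced_subgraph F A)" if "A \<in> P" for A
    proof (rule partition_connected_induced_subgraph[OF sF(3)])
      have t: "tight (deficiency l) (edges F) A" using P(2) that .
      then show "A \<subseteq> verts F" "finite A" "int (edges_in F A) = deficiency l A"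
        using sF(1) finV in_eq[OF sF(1)]
        by (auto simp: tight_def spanning_subgraph_def intro: finite_subset)
      show "finite (edges F)"
        using sF(1) finite_E finite_subset by (auto simp: spanning_subgraph_def)
      show "card (ends F e) = 2" if "e \<in> edges F" for e
        using sF(1) that card_ends[of e] by (auto simp: spanning_subgraph_def)
    qed
    show "\<not> joins_parts G P e" if e: "e \<in> edges G - (edges F \<union> edges FF)" for e
    proof
      assume "joins_parts G P e"
      then obtain x y A B where "ends G e = {x, y}" "A \<in> P" "B \<in> P" "A \<noteq> B" "x \<in> A" "y \<in> B"
        by (auto simp: joins_parts_def)
      moreover obtain C where "C \<in> P" "ends G e \<subseteq> C" using P(3)[OF e] by blast
      moreover have "D = D'" if "D \<in> P" "D' \<in> P" "z \<in> D" "z \<in> D'" for D D' z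
        using P(1) that by (auto simp: partition_on_def disjoint_def)
      ultimately show False by (metis insert_subset)
    qed
    fix e x y A
    assume e: "e \<in> edges G - edges FF" "A \<in> P" "ends G e = {x, y} \<and> x \<in> A \<and> y \<in> A"
    then obtain X where X: "ends G e \<subseteq> X" "X \<subseteq> A" "tight (deficiency ell) (edges FF) X"
      using P(4)[of e A] by auto
    have "rigid ell (induced_subgraph FF X)"
      by (rule rigid_induced_subgraph[OF sF(4)])
        (use X(3) sF(2) in_eq[OF sF(2)] in \<open>auto simp: tight_def spanning_subgraph_def\<close>)
    then show "\<exists>X. {x, y} \<subseteq> X \<and> X \<subseteq> A \<and> rigid ell (induced_subgraph FF X)"
      using X e(3) by auto
  qed
qed

end
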